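(* For every prime power $q\ge 2$ and all integers $t\ge 2$ and $k\ge 1$, \[ R_q(t;k) > (t-1)k. \]
   Context: For a prime power $q$ and integers $t\ge 1$, $k\ge 1$, the vector space Ramsey number $R_q(t;k)$ is the smallest integer $n$ such that for every coloring of the $1$-dimensional linear subspaces of $\mathbb{F}_q^n$ with $k$ colors there exists a $t$-dimensional linear subspace $U\le\mathbb{F}_q^n$ all of whose $1$-dimensional subspaces receive the same color. *)

theory Defs
  imports
    Complex_Main
    "HOL-Library.Cardinality"
    "HOL-Library.Extended_Nat"
    "HOL-Library.FuncSet"
    "HOL-Library.Function_Algebras"
    "HOL-Number_Theory.Prime_Powers"
begin

text \<open>
  The length of a coordinate vector varies inside the definition of the Ramsey number, so the
  spaces \<open>F^n\<close> are realised as a chain of subspaces of the vector space of all sequences over \<open>F\<close>: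
  a vector of \<open>F^n\<close> is a sequence vanishing from index \<open>n\<close> on.
\<close>

definition seq_scale :: "'a::field \<Rightarrow> (nat \<Rightarrow> 'a) \<Rightarrow> nat \<Rightarrow> 'a" where
  "seq_scale a v = (\<lambda>i. a * v i)"

global_interpretation seq: vector_space "seq_scale :: 'a::field \<Rightarrow> (nat \<Rightarrow> 'a) \<Rightarrow> nat \<Rightarrow> 'a"
  by unfold_locales (auto simp: seq_scale_def fun_eq_iff algebra_simps)

definition coord_space :: "nat \<Rightarrow> (nat \<Rightarrow> 'a::field) set" where
  "coord_space n = {v. \<forall>i\<ge>n. v i = 0}"

definition subspaces_of_dim :: "nat \<Rightarrow> nat \<Rightarrow> (nat \<Rightarrow> 'a::field) set set" where
  "subspaces_of_dim n d = {U. seq.subspace U \<and> U \<subseteq> coord_space n \<and> seq.dim U = d}"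

definition vs_ramsey_property :: "'a::field itself \<Rightarrow> nat \<Rightarrow> nat \<Rightarrow> nat \<Rightarrow> bool" where
  "vs_ramsey_property F t k n \<longleftrightarrow>
     (\<forall>c \<in> (subspaces_of_dim n 1 :: (nat \<Rightarrow> 'a) set set) \<rightarrow> {..<k}.
        \<exists>U \<in> subspaces_of_dim n t. \<exists>j.
          \<forall>L \<in> subspaces_of_dim n 1. L \<subseteq> U \<longrightarrow> c L = j)"

text \<open>
  The Ramsey number is the least element of the set below.  For a finite field this set is
  nonempty by the Graham--Leeb--Rothschild theorem, which is not proved here; the infimum is
  therefore taken in \<^typ>\<open>enat\<close>, where the infimum of the empty set is \<open>\<infinity>\<close>, rather than as a
  \<open>LEAST\<close> over \<^typ>\<open>nat\<close>, whose value would be unspecified if the set were empty.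
\<close>

definition vs_ramsey :: "'a::field itself \<Rightarrow> nat \<Rightarrow> nat \<Rightarrow> enat" where
  "vs_ramsey F t k = Inf (enat ` {n. vs_ramsey_property F t k n})"

end

theory Submission imports Defs begin

text \<open>
  Cut the \<open>(t - 1) k\<close> coordinates into \<open>k\<close> blocks of length \<open>t - 1\<close> and color a line by the block
  that contains the first coordinate in which it does not vanish. A subspace of dimension \<open>t\<close>
  contains, for each block, a nonzero vector vanishing on that block, and the line through this
  vector does not have the color of the block. So no \<open>t\<close>-dimensional subspace is monochromatic.
\<close>

interpretation seq_pair: vector_space_pair
  "seq_scale :: 'a::field \<Rightarrow> (nat \<Rightarrow> 'a) \<Rightarrow> nat \<Rightarrow> 'a"
  "seq_scale :: 'a::field \<Rightarrow> (nat \<Rightarrow> 'a) \<Rightarrow> nat \<Rightarrow> 'a"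
  by unfold_locales

text \<open>Restriction to the coordinates in \<open>S\<close> is linear with image in a span of at
  most \<open>card S\<close> vectors, so it cannot be injective on \<open>U\<close>.\<close>

lemma subspace_nonzero_vanishing_on:
  fixes U :: "(nat \<Rightarrow> 'a::field) set"
  assumes U: "seq.subspace U" and S: "finite S" and less: "card S < seq.dim U"
  obtains v where "v \<in> U" "v \<noteq> 0" "\<And>i. i \<in> S \<Longrightarrow> v i = 0"
proof (rule ccontr)
  assume "\<not> thesis"
  with that have only0: "v = 0" if "v \<in> U" "\<And>i. i \<in> S \<Longrightarrow> v i = 0" for v
    using that by blast
  \<comment> \<open>\<open>p\<close> overwrites the coordinates outside \<open>S\<close> with zeros,
    and the \<open>e i\<close> are the unit vectors; those with \<open>i \<in> S\<close> span the
    image of \<open>p\<close>.\<close>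
  define p where "p v = (\<lambda>i. if i \<in> S then v i else 0)" for v :: "nat \<Rightarrow> 'a"
  define e where "e i = (\<lambda>j. if j = i then 1 else 0 :: 'a)" for i :: nat
  have lin: "Vector_Spaces.linear seq_scale seq_scale p"
    by unfold_locales (auto simp: p_def seq_scale_def fun_eq_iff)
  obtain B where B: "B \<subseteq> U" "seq.independent B" "U \<subseteq> seq.span B" "card B = seq.dim U"
    using seq.basis_exists by blast
  have span_B: "seq.span B = U"
    using B U seq.span_minimal by blast
  \<comment> \<open>The kernel of \<open>p\<close> on \<open>U\<close> consists of the vectors
    vanishing on \<open>S\<close>, so it is trivial by \<open>only0\<close>.\<close>
  have inj: "inj_on p (seq.span B)"
    unfolding span_B seq_pair.linear_inj_on_iff_eq_0[OF lin U]
  proof (intro ballI impI)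
    fix v assume "v \<in> U" and pv: "p v = 0"
    moreover have "v i = 0" if "i \<in> S" for i
      using fun_cong[OF pv, of i] that by (simp add: p_def)
    ultimately show "v = 0"
      using only0 by blast
  qed
  have "seq.independent (p ` B)"
    using seq_pair.linear_independent_injective_image[OF lin B(2) inj] .
  moreover have "p ` B \<subseteq> seq.span (e ` S)"
  proof
    fix w assume "w \<in> p ` B"
    then obtain v where w: "w = p v" by blast
    have "(\<Sum>i\<in>S. v i * e i j) = (if j \<in> S then v j else 0)" for j
      using S by (simp add: e_def if_distrib cong: if_cong)
    moreover have "(\<Sum>i\<in>S. seq_scale (v i) (e i)) j = (\<Sum>i\<in>S. v i * e i j)" for j
      using S by (induction S) (auto simp: seq_scale_def)
    ultimately have "w = (\<Sum>i\<in>S. seq_scale (v i) (e i))"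
      by (simp add: w p_def fun_eq_iff)
    also have "\<dots> \<in> seq.span (e ` S)"
      by (intro seq.span_sum seq.span_scale seq.span_base imageI)
    finally show "w \<in> seq.span (e ` S)" .
  qed
  ultimately have "card (p ` B) \<le> card (e ` S)"
    using seq.independent_span_bound S by blast
  moreover have "card (p ` B) = card B"
    by (rule card_image) (rule inj_on_subset[OF inj seq.span_superset])
  ultimately show False
    using card_image_le[OF S, of e] B(4) less by linarith
qed

lemma span_singleton_in_subspaces_of_dim_1:
  assumes "v \<in> coord_space n" "v \<noteq> 0"
  shows "seq.span {v} \<in> subspaces_of_dim n 1"
proof -
  have "seq.subspace (coord_space n :: (nat \<Rightarrow> 'a) set)"
    by (auto simp: seq.subspace_def coord_space_def seq_scale_def)
  then have "seq.span {v} \<subseteq> coord_space n"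
    using assms(1) by (intro seq.span_minimal) auto
  moreover have "seq.dim (seq.span {v}) = 1"
    using seq.dim_span_eq_card_independent[of "{v}"] assms(2) by simp
  ultimately show ?thesis
    by (simp add: subspaces_of_dim_def)
qed

text \<open>Guarantees that the leading coordinate of a line exists and lies below
  \<open>n\<close>.\<close>

lemma subspaces_of_dim_1_nonzero:
  assumes "L \<in> subspaces_of_dim n 1"
  obtains v i where "v \<in> L" "i < n" "v i \<noteq> 0"
proof -
  have "\<not> L \<subseteq> {0}"
  proof
    assume "L \<subseteq> {0}"
    then have "seq.dim L \<le> card ({} :: (nat \<Rightarrow> 'a) set)"
      by (intro seq.dim_le_card) auto
    with assms show False
      by (simp add: subspaces_of_dim_def)
  qed
  then obtain v i where "v \<in> L" "v i \<noteq> 0"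
    by (force simp: fun_eq_iff)
  moreover have "i < n"
    using assms calculation by (auto simp: subspaces_of_dim_def coord_space_def subset_iff not_less[symmetric])
  ultimately show thesis
    using that by blast
qed

text \<open>Here \<open>s\<close> is the block length \<open>t - 1\<close>. Treating all
  \<open>n \<le> s * k\<close> at once bounds the infimum without an argument that the property is
  monotone in \<open>n\<close>.\<close>

lemma not_vs_ramsey_property:
  assumes n: "n \<le> s * k"
  shows "\<not> vs_ramsey_property TYPE('a::field) (Suc s) k n"
proof
  \<comment> \<open>Quantifying over all vectors of \<open>L\<close> avoids the choice of a
    generator.\<close>
  define lead where "lead L = (LEAST i. \<exists>v\<in>L. v i \<noteq> 0)" for L :: "(nat \<Rightarrow> 'a) set"
  define c where "c L = lead L div s" for L
  have lead: "lead L < n" "\<exists>v\<in>L. v (lead L) \<noteq> 0" if L: "L \<in> subspaces_of_dim n 1" for L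
  proof -
    obtain v i where vi: "v \<in> L" "i < n" "v i \<noteq> 0"
      using subspaces_of_dim_1_nonzero[OF L] .
    then show "\<exists>v\<in>L. v (lead L) \<noteq> 0"
      unfolding lead_def by - (rule LeastI[of _ i], blast)
    have "lead L \<le> i"
      unfolding lead_def using vi by - (rule Least_le, blast)
    with vi show "lead L < n" by simp
  qed
  assume "vs_ramsey_property TYPE('a) (Suc s) k n"
  moreover have "c \<in> subspaces_of_dim n 1 \<rightarrow> {..<k}"
  proof
    fix L :: "(nat \<Rightarrow> 'a) set" assume "L \<in> subspaces_of_dim n 1"
    then have "lead L < k * s"
      using lead(1) n by (metis less_le_trans mult.commute)
    then show "c L \<in> {..<k}"
      by (simp add: c_def less_mult_imp_div_less)
  qed
  ultimately have "\<exists>U \<in> subspaces_of_dim n (Suc s). \<exists>j.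
      \<forall>L \<in> subspaces_of_dim n 1. L \<subseteq> U \<longrightarrow> c L = j"
    unfolding vs_ramsey_property_def by (rule bspec)
  then obtain U j where U: "U \<in> subspaces_of_dim n (Suc s)"
    and mono: "\<forall>L \<in> subspaces_of_dim n 1. L \<subseteq> U \<longrightarrow> c L = j"
    by (elim bexE exE)
  have sub: "seq.subspace U" "U \<subseteq> coord_space n" "seq.dim U = Suc s"
    using U by (auto simp: subspaces_of_dim_def)
  \<comment> \<open>The block of color \<open>j\<close> has \<open>s\<close> coordinates, one fewer
    than the dimension of \<open>U\<close>. It need not lie below \<open>n\<close>; only its size
    matters.\<close>
  obtain v where v: "v \<in> U" "v \<noteq> 0" "\<And>i. i \<in> {j * s..<j * s + s} \<Longrightarrow> v i = 0"
    using subspace_nonzero_vanishing_on[OF sub(1), of "{j * s..<j * s + s}"] sub(3) by auto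
  define L where "L = seq.span {v}"
  have L: "L \<in> subspaces_of_dim n 1"
    unfolding L_def using v sub by (intro span_singleton_in_subspaces_of_dim_1) auto
  have "L \<subseteq> U"
    unfolding L_def using v sub by (intro seq.span_minimal) auto
  then have "lead L div s = j"
    using mono L by (simp add: c_def)
  \<comment> \<open>For \<open>s = 0\<close> there would be no coordinates, hence no line
    \<open>L\<close>. Positivity is what lets \<open>lead L div s = j\<close> place
    \<open>lead L\<close> in block \<open>j\<close>.\<close>
  moreover have "s > 0"
    using lead(1)[OF L] n by (cases s) auto
  ultimately have "lead L \<in> {j * s..<j * s + s}"
    using dividend_less_div_times[of s "lead L"] by (auto simp: add.commute)
  then have "v (lead L) = 0"
    by (rule v(3))
  \<comment> \<open>All vectors of \<open>L\<close> are multiples of \<open>v\<close>, so they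
    vanish at \<open>lead L\<close> too.\<close>
  then show False
    using lead(2)[OF L] by (auto simp: L_def seq.span_singleton seq_scale_def)
qed

theorem theorem1p5:
  fixes q t k :: nat
  assumes "primepow q"
    and "CARD('a::{field,finite}) = q"
    and "t \<ge> 2"
    and "k \<ge> 1"
  shows "vs_ramsey TYPE('a) t k > enat ((t - 1) * k)"
proof -
  have "(t - 1) * k < n" if "vs_ramsey_property TYPE('a) t k n" for n
    using not_vs_ramsey_property[of n "t - 1" k, where 'a = 'a] that \<open>t \<ge> 2\<close> by fastforce
  \<comment> \<open>An infimum preserves only weak bounds, so the strict bound is first turned into
    a weak one by passing to the successor. This also covers an empty set, with infimum
    \<open>\<infinity>\<close>.\<close>
  then have "eSuc (enat ((t - 1) * k)) \<le> vs_ramsey TYPE('a) t k"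
    unfolding vs_ramsey_def by (intro Inf_greatest) (auto simp: eSuc_enat Suc_le_eq)
  then show ?thesis
    by (simp add: eSuc_enat Suc_ile_eq)
qed

end
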